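(* Let $G$ be a finite group of order $v$ and let $S \subseteq G$ with $|S| = k$. Consider the statements: (i) $S$ is a $(v,k,\lambda)$ difference set; (ii) $S$ is a $(v,k,\mu)$ sum set; (iii) $S = S^{(-1)}$. Then any two of (i), (ii), (iii) imply the third. In particular, a $(v,k,\lambda)$ difference set $S$ is also a sum set if and only if $S = S^{(-1)}$.
   Context: For $a \in G$, the number of ways to write $a$ as a product in $S$ is the number of ordered pairs $(x,y) \in S \times S$ with $xy = a$; the number of ways to write $a$ as a quotient in $S$ is the number of ordered pairs $(x,y)\in S\times S$ with $xy^{-1} = a$. $S$ is a $(v,k,\lambda)$ difference set if every nonidentity element of $G$ can be written as a quotient in $S$ in exactly $\lambda$ ways. $S$ is a $(v,k,\mu)$ sum set if every nonidentity element of $G$ can be written as a product in $S$ in exactly $\mu$ ways. $S^{(-1)} = \{s^{-1} : s \in S\}$. *)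

theory Defs
  imports "HOL-Algebra.Coset"
begin

definition product_ways :: "('a, 'b) monoid_scheme \<Rightarrow> 'a set \<Rightarrow> 'a \<Rightarrow> nat" where
  "product_ways G S a = card {(x, y). x \<in> S \<and> y \<in> S \<and> x \<otimes>\<^bsub>G\<^esub> y = a}"

definition quotient_ways :: "('a, 'b) monoid_scheme \<Rightarrow> 'a set \<Rightarrow> 'a \<Rightarrow> nat" where
  "quotient_ways G S a = card {(x, y). x \<in> S \<and> y \<in> S \<and> x \<otimes>\<^bsub>G\<^esub> inv\<^bsub>G\<^esub> y = a}"

text \<open>Degenerate parameters (such as the empty set, or the whole group) are allowed.\<close>

definition difference_set :: "('a, 'b) monoid_scheme \<Rightarrow> 'a set \<Rightarrow> nat \<Rightarrow> nat \<Rightarrow> nat \<Rightarrow> bool" where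
  "difference_set G S v k l \<longleftrightarrow>
     order G = v \<and> S \<subseteq> carrier G \<and> card S = k \<and>
     (\<forall>a \<in> carrier G - {\<one>\<^bsub>G\<^esub>}. quotient_ways G S a = l)"

definition sum_set :: "('a, 'b) monoid_scheme \<Rightarrow> 'a set \<Rightarrow> nat \<Rightarrow> nat \<Rightarrow> nat \<Rightarrow> bool" where
  "sum_set G S v k m \<longleftrightarrow>
     order G = v \<and> S \<subseteq> carrier G \<and> card S = k \<and>
     (\<forall>a \<in> carrier G - {\<one>\<^bsub>G\<^esub>}. product_ways G S a = m)"

end

(* Suppose S is both a difference set and a sum set, and let e be the number of s in S whose
   inverse is in S. Counting pairs gives k^2 = k + (v - 1) l = e + (v - 1) m. Counting the
   triples with x y = z in S in two ways gives k + (k - 1) l = e + (k - 1) m or k l = k m,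
   according to whether S contains the identity. Hence S is empty, or S = G, or l = m; in the
   last case e = k, which means that S is closed under inversion. *)
theory Submission
  imports Defs
begin

text \<open>Writing a count as a sum of indicators lets the triple count below be reordered by
  exchanging sums.\<close>

lemma card_pairs_eq_sum:
  assumes "finite S" and "finite T"
  shows "card {(x, y). x \<in> S \<and> y \<in> T \<and> P x y} = (\<Sum>x\<in>S. \<Sum>y\<in>T. of_bool (P x y))"
proof -
  have "{(x, y). x \<in> S \<and> y \<in> T \<and> P x y} = (SIGMA x:S. {y \<in> T. P x y})"
    by auto
  also have "card \<dots> = (\<Sum>x\<in>S. card {y \<in> T. P x y})"
    using assms by (intro card_SigmaI) auto
  also have "\<dots> = (\<Sum>x\<in>S. \<Sum>y\<in>T. of_bool (P x y))"
    using assms by (intro sum.cong) (auto simp: Int_def)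
  finally show ?thesis .
qed

text \<open>The fibres of \<open>f\<close> over \<open>C\<close> partition
  \<open>S \<times> S\<close>. With \<open>f\<close> the quotient and then the product, this yields
  the two pair counts.\<close>

lemma sum_card_pair_fibres:
  assumes "finite C" and "finite S" and "\<And>x y. x \<in> S \<Longrightarrow> y \<in> S \<Longrightarrow> f x y \<in> C"
  shows "(\<Sum>a\<in>C. card {(x, y). x \<in> S \<and> y \<in> S \<and> f x y = a}) = card S * card S"
proof -
  have "(\<Sum>a\<in>C. card {(x, y). x \<in> S \<and> y \<in> S \<and> f x y = a}) =
      (\<Sum>a\<in>C. \<Sum>p\<in>{p \<in> S \<times> S. case_prod f p = a}. 1)"
    by (intro sum.cong) (auto intro!: arg_cong[where f = card])
  also have "\<dots> = (\<Sum>p\<in>S \<times> S. 1)"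
    using assms by (intro sum.group) auto
  finally show ?thesis
    by (simp add: card_cartesian_product)
qed

context group
begin

text \<open>Closure alone suffices because inversion is an involution: each \<open>x\<close> in
  \<open>S\<close> is the inverse of \<open>inv x\<close>.\<close>

lemma set_inv_eq_iff:
  assumes "S \<subseteq> carrier G"
  shows "S = set_inv S \<longleftrightarrow> (\<forall>x\<in>S. inv x \<in> S)"
proof
  show "\<forall>x\<in>S. inv x \<in> S" if "S = set_inv S"
    using that by (auto simp: SET_INV_def)
next
  assume closed: "\<forall>x\<in>S. inv x \<in> S"
  have "x \<in> set_inv S" if "x \<in> S" for x
    using that closed assms by (auto simp: SET_INV_def intro!: bexI[of _ "inv x"])
  then show "S = set_inv S"
    using closed by (auto simp: SET_INV_def)
qed

text \<open>Inverting the second entry is an involution on pairs from \<open>S\<close> that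
  exchanges representations as a quotient with representations as a product.\<close>

lemma quotient_ways_eq_product_ways:
  assumes "S \<subseteq> carrier G" and "S = set_inv S"
  shows "quotient_ways G S a = product_ways G S a"
proof -
  have closed: "inv x \<in> S" if "x \<in> S" for x
    using assms set_inv_eq_iff that by blast
  show ?thesis
    unfolding quotient_ways_def product_ways_def
    by (rule bij_betw_same_card[of "\<lambda>(x, y). (x, inv y)"],
        rule bij_betw_byWitness[where f' = "\<lambda>(x, y). (x, inv y)"])
      (use assms(1) closed in \<open>auto simp: subset_iff\<close>)
qed

lemma quotient_ways_one:
  assumes "S \<subseteq> carrier G"
  shows "quotient_ways G S \<one> = card S"
proof -
  have "{(x, y). x \<in> S \<and> y \<in> S \<and> x \<otimes> inv y = \<one>} = (\<lambda>x. (x, x)) ` S"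
    using assms by (auto simp: inv_solve_right' subset_iff)
  then show ?thesis
    by (simp add: quotient_ways_def card_image inj_on_def)
qed

text \<open>The only possible partner of \<open>x\<close> is \<open>inv x\<close>, and it counts
  only if it lies in \<open>S\<close>. So the count at the identity measures how far
  \<open>S\<close> is closed under inversion.\<close>

lemma product_ways_one:
  assumes "S \<subseteq> carrier G"
  shows "product_ways G S \<one> = card {x \<in> S. inv x \<in> S}"
proof -
  have "{(x, y). x \<in> S \<and> y \<in> S \<and> x \<otimes> y = \<one>} = (\<lambda>x. (x, inv x)) ` {x \<in> S. inv x \<in> S}"
    using assms inv_comm inv_equality by (fastforce simp: subset_iff image_iff)
  then show ?thesis
    by (simp add: product_ways_def card_image inj_on_def)
qed

text \<open>Both sides count the triples in \<open>S\<close> with \<open>x \<otimes> y = z\<close>, sorted by \<open>x\<close> on the left and by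
  \<open>z\<close> on the right.\<close>

lemma sum_quotient_ways_inv_eq_sum_product_ways:
  assumes "S \<subseteq> carrier G" and "finite S"
  shows "(\<Sum>x\<in>S. quotient_ways G S (inv x)) = (\<Sum>z\<in>S. product_ways G S z)"
proof -
  \<comment> \<open>For fixed \<open>x\<close>, the pairs with quotient \<open>inv x\<close> are
    exactly those completing \<open>x\<close> to a triple.\<close>
  have iff: "y \<otimes> inv z = inv x \<longleftrightarrow> x \<otimes> y = z" if "x \<in> S" "y \<in> S" "z \<in> S" for x y z
  proof -
    have "x \<in> carrier G" "y \<in> carrier G" "z \<in> carrier G"
      using that assms by auto
    then show ?thesis
      by (auto simp: inv_solve_right' inv_solve_left)
  qed
  have "(\<Sum>x\<in>S. quotient_ways G S (inv x)) =
      (\<Sum>x\<in>S. \<Sum>y\<in>S. \<Sum>z\<in>S. of_bool (y \<otimes> inv z = inv x))"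
    by (simp only: quotient_ways_def card_pairs_eq_sum[OF assms(2) assms(2)])
  also have "\<dots> = (\<Sum>x\<in>S. \<Sum>y\<in>S. \<Sum>z\<in>S. of_bool (x \<otimes> y = z))"
    by (intro sum.cong refl) (simp only: iff)
  also have "\<dots> = (\<Sum>x\<in>S. \<Sum>z\<in>S. \<Sum>y\<in>S. of_bool (x \<otimes> y = z))"
    by (intro sum.cong refl sum.swap)
  also have "\<dots> = (\<Sum>z\<in>S. \<Sum>x\<in>S. \<Sum>y\<in>S. of_bool (x \<otimes> y = z))"
    by (rule sum.swap)
  also have "\<dots> = (\<Sum>z\<in>S. product_ways G S z)"
    by (simp only: product_ways_def card_pairs_eq_sum[OF assms(2) assms(2)])
  finally show ?thesis .
qed

lemma difference_set_sum_set_imp_set_inv: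
  assumes fin: "finite (carrier G)"
    and diff: "difference_set G S v k l" and sum: "sum_set G S v k m"
  shows "S = set_inv S"
proof -
  have S: "S \<subseteq> carrier G" and v: "card (carrier G) = v" and k: "card S = k"
    and q: "\<And>a. a \<in> carrier G \<Longrightarrow> a \<noteq> \<one> \<Longrightarrow> quotient_ways G S a = l"
    and p: "\<And>a. a \<in> carrier G \<Longrightarrow> a \<noteq> \<one> \<Longrightarrow> product_ways G S a = m"
    using diff sum by (auto simp: difference_set_def sum_set_def order_def)
  have finS: "finite S"
    using S fin by (rule finite_subset)
  define e where "e = card {x \<in> S. inv x \<in> S}"
  have q1: "quotient_ways G S \<one> = k" and p1: "product_ways G S \<one> = e"
    using quotient_ways_one[OF S] product_ways_one[OF S] k e_def by auto
  have "(\<Sum>a\<in>carrier G. quotient_ways G S a) = k * k"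
    unfolding quotient_ways_def k[symmetric]
    by (rule sum_card_pair_fibres) (use fin finS S in auto)
  then have pairs_q: "k + (v - 1) * l = k * k"
    using fin v by (simp add: sum.remove[of "carrier G" \<one>] q q1)
  have "(\<Sum>a\<in>carrier G. product_ways G S a) = k * k"
    unfolding product_ways_def k[symmetric]
    by (rule sum_card_pair_fibres) (use fin finS S in auto)
  then have pairs_p: "e + (v - 1) * m = k * k"
    using fin v by (simp add: sum.remove[of "carrier G" \<one>] p p1)
  \<comment> \<open>This makes \<open>q\<close> applicable to the terms
    \<open>quotient_ways G S (inv x)\<close> of the triple count.\<close>
  have inv_ne: "inv x \<noteq> \<one>" if "x \<in> carrier G" "x \<noteq> \<one>" for x
    using that by (metis inv_inv inv_one)
  note triples = sum_quotient_ways_inv_eq_sum_product_ways[OF S finS]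
  have "S = {} \<or> S = carrier G \<or> l = m"
  proof (cases "\<one> \<in> S")
    case True
    have in_S: "x \<in> carrier G" if "x \<in> S" for x
      using that S by auto
    \<comment> \<open>The identity, which is its own inverse, contributes \<open>k\<close> on the
      left and \<open>e\<close> on the right; the other \<open>k - 1\<close> elements contribute
      \<open>l\<close> and \<open>m\<close> each.\<close>
    have "k + (k - 1) * l = e + (k - 1) * m"
      using triples finS k True
      by (simp add: sum.remove[OF finS True] q q1 p p1 in_S inv_ne)
    then have triples': "int k + int (k - 1) * int l = int e + int (k - 1) * int m"
      by (metis of_nat_add of_nat_mult)
    have pairs: "int k + int (v - 1) * int l = int e + int (v - 1) * int m"
      using pairs_p pairs_q by (metis of_nat_add of_nat_mult)
    \<comment> \<open>Positivity ensures that the truncated \<open>k - 1\<close> and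
      \<open>v - 1\<close> agree with integer subtraction.\<close>
    have "0 < card S" and "0 < card (carrier G)"
      unfolding card_gt_0_iff using True finS fin one_closed by fast+
    then have "k \<noteq> 0" and "v \<noteq> 0"
      using k v by simp_all
    then have "int (k - 1) = int k - 1" and "int (v - 1) = int v - 1"
      by auto
    \<comment> \<open>Both \<open>(v - 1) * (l - m)\<close> and \<open>(k - 1) * (l - m)\<close>
      equal \<open>e - k\<close>; subtract.\<close>
    then have "(int v - int k) * (int l - int m) = 0"
      using triples' pairs by (simp add: algebra_simps)
    then have "v = k \<or> l = m"
      by simp
    then show ?thesis
      using card_subset_eq[OF fin S] unfolding v k by blast
  next
    case False
    then have "x \<in> carrier G \<and> x \<noteq> \<one>" if "x \<in> S" for x
      using that S by auto
    then have "k * l = k * m"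
      using triples k by (simp add: q p inv_ne)
    \<comment> \<open>Cancelling \<open>k\<close> fails only for \<open>k = 0\<close>, that is, for
      empty \<open>S\<close>.\<close>
    then show ?thesis
      using k finS by auto
  qed
  then have "\<forall>x\<in>S. inv x \<in> S"
  proof (elim disjE)
    \<comment> \<open>The pair counts now cancel to \<open>e = k\<close>. The other two cases,
      \<open>S\<close> empty or the whole group, are closed trivially.\<close>
    assume "l = m"
    then have "card {x \<in> S. inv x \<in> S} = card S"
      using pairs_p pairs_q k e_def by simp
    then have "{x \<in> S. inv x \<in> S} = S"
      using finS by (intro card_subset_eq) auto
    then show ?thesis
      by auto
  qed auto
  then show ?thesis
    using set_inv_eq_iff[OF S] by blast
qed

text \<open>The two directions give the implications from (iii) with (i) and from (iii) with (ii),
  with the same parameter.\<close>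

lemma difference_set_iff_sum_set:
  assumes "S \<subseteq> carrier G" and "S = set_inv S"
  shows "difference_set G S v k l \<longleftrightarrow> sum_set G S v k l"
  unfolding difference_set_def sum_set_def
  by (simp only: quotient_ways_eq_product_ways[OF assms])

end

theorem theorem2p2:
  fixes G :: "('a, 'b) monoid_scheme" and S :: "'a set" and v k :: nat
  assumes "group G" and "finite (carrier G)" and "order G = v"
    and "S \<subseteq> carrier G" and "card S = k"
  shows "((\<exists>l. difference_set G S v k l) \<and> (\<exists>m. sum_set G S v k m) \<longrightarrow> S = set_inv\<^bsub>G\<^esub> S)
    \<and> ((\<exists>l. difference_set G S v k l) \<and> S = set_inv\<^bsub>G\<^esub> S \<longrightarrow> (\<exists>m. sum_set G S v k m))
    \<and> ((\<exists>m. sum_set G S v k m) \<and> S = set_inv\<^bsub>G\<^esub> S \<longrightarrow> (\<exists>l. difference_set G S v k l))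
    \<and> (\<forall>l. difference_set G S v k l \<longrightarrow> ((\<exists>m. sum_set G S v k m) \<longleftrightarrow> S = set_inv\<^bsub>G\<^esub> S))"
proof -
  interpret group G by fact
  show ?thesis
    using difference_set_sum_set_imp_set_inv[OF assms(2)]
      difference_set_iff_sum_set[OF assms(4)]
    by blast
qed

end
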